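(* Let $\mathcal{S}$ be a high-density subset of the squares, and suppose that $\mathcal{A}\subseteq\mathbb{N}$ has complementary density growth exponent smaller than $1$. Then, whenever $\varepsilon>0$ and $N$ is a natural number sufficiently large in terms of $\varepsilon$ (for the given sets $\mathcal{S}$ and $\mathcal{A}$), one has $$\left|\overline{\mathcal{A}+\mathcal{S}}\right|_{2N}^{3N}\ll N^{\varepsilon-1/2}\left|\overline{\mathcal{A}}\right|_N^{3N}.$$
   Context: $\mathbb{N}$ denotes the set of positive integers. For $\mathcal{C}\subseteq\mathbb{N}$, $\overline{\mathcal{C}}=\mathbb{N}\setminus\mathcal{C}$; for non-negative integers $a,b$, $|\mathcal{C}|_a^b$ is the cardinality of $\mathcal{C}\cap(a,b]$; and $\mathcal{C}+\mathcal{D}=\{c+d:c\in\mathcal{C},\ d\in\mathcal{D}\}$. For a natural number $k$, a subset $\mathcal{Q}$ of $\mathbb{N}$ is a high-density subset of the $k$th powers when (i) $\mathcal{Q}\subseteq\{n^k:n\in\mathbb{N}\}$, and (ii) for each $\varepsilon>0$, whenever $N$ is a natural number sufficiently large in terms of $\varepsilon$, one has $|\mathcal{Q}|_0^N>N^{1/k-\varepsilon}$. The squares are the case $k=2$. For $\theta>0$, a set $\mathcal{R}\subseteq\mathbb{N}$ has complementary density growth exponent smaller than $\theta$ when there exists $\delta>0$ such that, for all sufficiently large natural numbers $N$, one has $\left|\overline{\mathcal{R}}\right|_0^N<N^{\theta-\delta}$. The notation $X\ll Y$ means $|X|\leqslant CY$ for a constant $C$ depending at most on $\varepsilon$. The sets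 $\mathcal{S},\mathcal{A}$ are fixed first, and the threshold beyond which $N$ must lie may depend on $\varepsilon$ and on these sets. *)

theory Defs
  imports Complex_Main "HOL-Library.Set_Algebras"
begin

text \<open>
  Sets of positive integers are sets of type \<^typ>\<open>nat set\<close> contained in \<open>{0<..}\<close>;
  complements are relative to \<open>{0<..}\<close>. The sumset is \<open>A + B\<close> of
  \<^theory>\<open>HOL-Library.Set_Algebras\<close>.
\<close>

definition pos_compl :: "nat set \<Rightarrow> nat set" where
  "pos_compl C = {0<..} - C"

definition count_in :: "nat set \<Rightarrow> nat \<Rightarrow> nat \<Rightarrow> nat" where
  "count_in C a b = card (C \<inter> {a<..b})"

definition high_density_powers :: "nat \<Rightarrow> nat set \<Rightarrow> bool" where
  "high_density_powers k Q \<longleftrightarrow>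
     Q \<subseteq> {n ^ k | n. n > 0} \<and>
     (\<forall>\<epsilon>::real. \<epsilon> > 0 \<longrightarrow>
        (\<forall>\<^sub>F N in sequentially. real (count_in Q 0 N) > real N powr (1 / real k - \<epsilon>)))"

definition compl_growth_exponent_less :: "nat set \<Rightarrow> real \<Rightarrow> bool" where
  "compl_growth_exponent_less R \<theta> \<longleftrightarrow>
     (\<exists>\<delta>>0. \<forall>\<^sub>F N in sequentially.
        real (count_in (pos_compl R) 0 N) < real N powr (\<theta> - \<delta>))"

end

theory Submission
  imports Defs "HOL-Computational_Algebra.Primes" "HOL-Analysis.Convex" "HOL-Real_Asymp.Real_Asymp"
begin

text \<open>
  Let \<open>Z\<close> be the set of \<open>n \<in> (2N, 3N]\<close> outside \<open>A + S\<close>, and let \<open>B\<close> be the part of the complement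
  of \<open>A\<close> in \<open>(N, 3N]\<close>. For \<open>n \<in> Z\<close> and \<open>s \<in> S\<close> with \<open>s \<le> N\<close> the difference \<open>n - s\<close> lies in \<open>B\<close>, so
  by Cauchy--Schwarz \<open>(|Z| |S|)\<^sup>2\<close> is at most \<open>|B|\<close> times the number of solutions of
  \<open>n\<^sub>1 - s\<^sub>1 = n\<^sub>2 - s\<^sub>2\<close>. There are \<open>|Z| |S|\<close> diagonal solutions, and since \<open>s\<^sub>1 - s\<^sub>2\<close> is a difference
  of two squares, the divisor bound leaves at most \<open>O(N\<^sup>\<eta>)\<close> solutions for each pair
  \<open>n\<^sub>1 \<noteq> n\<^sub>2\<close>. If the latter dominate then \<open>|S|\<^sup>2 = O(|B| N\<^sup>\<eta>)\<close>, contradicting the density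
  hypotheses; hence the diagonal dominates and \<open>|Z| = O(|B| / |S|)\<close>.
\<close>

section \<open>The divisor bound\<close>

lemma divisors_mult_subset:
  fixes m n :: nat
  shows "{d. d dvd m * n} \<subseteq> (\<lambda>(a, b). a * b) ` ({d. d dvd m} \<times> {d. d dvd n})"
  by (force dest: division_decomp)

lemma card_divisors_mult_le:
  fixes m n :: nat
  assumes "m > 0" "n > 0"
  shows "card {d. d dvd m * n} \<le> card {d. d dvd m} * card {d. d dvd n}"
proof -
  have fin: "finite ({d. d dvd m} \<times> {d. d dvd n})"
    using assms by simp
  have "card {d. d dvd m * n} \<le> card ((\<lambda>(a, b). a * b) ` ({d. d dvd m} \<times> {d. d dvd n}))"
    using divisors_mult_subset fin by (intro card_mono) auto
  also have "\<dots> \<le> card ({d. d dvd m} \<times> {d. d dvd n})"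
    using fin by (rule card_image_le)
  finally show ?thesis
    by (simp add: card_cartesian_product)
qed

lemma card_divisors_prime_power_le:
  fixes p :: nat
  assumes "prime p"
  shows "card {d. d dvd p ^ k} \<le> Suc k"
proof -
  have "{d. d dvd p ^ k} \<subseteq> (\<lambda>i. p ^ i) ` {..k}"
    using assms by (auto simp: divides_primepow_nat)
  then have "card {d. d dvd p ^ k} \<le> card ((\<lambda>i. p ^ i) ` {..k})"
    by (intro card_mono) auto
  also have "\<dots> \<le> card {..k}"
    by (rule card_image_le) simp
  finally show ?thesis by simp
qed

text \<open>For p \<ge> P already \<open>p powr \<eta> \<ge> 2\<close>, and \<open>2 ^ k\<close>
  exceeds k. For smaller p the base may be close to 1, but its powers are still at least
  \<open>2 powr (\<eta> * k)\<close>, which dominates k + 1 after a loss of the fixed factor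
  M.\<close>

lemma Suc_le_prime_power_powr:
  fixes \<eta> M :: real and p P k :: nat
  assumes "\<eta> > 0" "p \<ge> 2"
    and M: "M \<ge> 1" "M * (\<eta> * ln 2) \<ge> 1" and P: "real P \<ge> 2 powr (1 / \<eta>)"
  shows "real (Suc k) \<le> (if p < P then M else 1) * real (p ^ k) powr \<eta>"
proof -
  have pk: "real (p ^ k) powr \<eta> = (real p powr \<eta>) ^ k"
    using assms(2) by (simp add: powr_realpow[symmetric] powr_powr mult.commute)
  show ?thesis
  proof (cases "p < P")
    case True
    have "1 + \<eta> * ln 2 * real k \<le> exp (\<eta> * ln 2 * real k)"
      by (rule exp_ge_add_one_self)
    also have "\<dots> = (2 powr \<eta>) ^ k"
      by (simp add: powr_def exp_of_nat2_mult)
    also have "\<dots> \<le> (real p powr \<eta>) ^ k"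
      using assms by (intro power_mono powr_mono2) auto
    \<comment> \<open>The two conditions on M handle the two terms of 1 + k: M \<ge> 1 the constant
      one, \<open>M * (\<eta> * ln 2) \<ge> 1\<close> the linear one.\<close>
    finally have "M * (1 + \<eta> * ln 2 * real k) \<le> M * (real p powr \<eta>) ^ k"
      using M by (intro mult_left_mono) auto
    moreover have "1 * real k \<le> M * (\<eta> * ln 2) * real k"
      using M by (intro mult_right_mono) auto
    ultimately show ?thesis
      using M True unfolding pk by (simp add: algebra_simps)
  next
    case False
    have "2 = (2 powr (1 / \<eta>)) powr \<eta>"
      using assms by (simp add: powr_powr)
    also have "\<dots> \<le> real p powr \<eta>"
      using assms False by (intro powr_mono2) auto
    finally have "2 ^ k \<le> (real p powr \<eta>) ^ k"
      by (intro power_mono) auto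
    moreover have "real (Suc k) \<le> 2 ^ k"
      using Suc_leI[OF less_exp[of k]] by (metis of_nat_le_iff of_nat_numeral of_nat_power)
    ultimately show ?thesis
      using False unfolding pk by simp
  qed
qed

text \<open>Induction by splitting off the full power of one prime. A factor M is paid only for
  primes below P, so the total loss is bounded independently of n.\<close>

lemma card_divisors_le_power_mult_powr:
  fixes \<eta> M :: real and P n :: nat
  assumes "\<eta> > 0" "M \<ge> 1" "M * (\<eta> * ln 2) \<ge> 1" "real P \<ge> 2 powr (1 / \<eta>)"
    and "n > 0"
  shows "real (card {d. d dvd n}) \<le> M ^ card (prime_factors n \<inter> {..<P}) * real n powr \<eta>"
  using \<open>n > 0\<close>
proof (induction n rule: less_induct)
  case (less n)
  show ?case
  proof (cases "n = 1")
    case True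
    then show ?thesis by simp
  next
    case False
    then obtain p where p: "prime p" "p dvd n"
      using prime_factor_nat by blast
    define k where "k = multiplicity p n"
    obtain m where m: "n = p ^ k * m" "\<not> p dvd m"
      using less.prems p multiplicity_decompose'[of n p] not_prime_unit unfolding k_def
      by (metis less_numeral_extra(3))
    have "k > 0"
      using m p by (metis gr0I mult_1 power_0)
    have m0: "m > 0"
      using less.prems m by (auto intro: gr0I)
    have p2: "p \<ge> 2"
      using p prime_ge_2_nat by blast
    have "1 < p ^ k"
      using p2 \<open>k > 0\<close> by (intro one_less_power) auto
    then have "m < n"
      using m m0 by simp
    have pf: "prime_factors n = insert p (prime_factors m)"
    proof -
      have "q dvd n \<longleftrightarrow> q = p \<or> q dvd m" if "prime q" for q
        using m(1) p \<open>k > 0\<close> that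
        by (metis dvd_refl prime_dvd_mult_iff prime_dvd_power_iff primes_dvd_imp_eq)
      then show ?thesis
        using p(1) less.prems m0 by (auto simp: prime_factors_dvd)
    qed
    have notin: "p \<notin> prime_factors m"
      using m by auto
    have M_eq: "M ^ card (prime_factors n \<inter> {..<P}) =
        (if p < P then M else 1) * M ^ card (prime_factors m \<inter> {..<P})"
      using notin by (simp add: pf Int_insert_left)
    have "real (card {d. d dvd n}) \<le> real (card {d. d dvd p ^ k} * card {d. d dvd m})"
      unfolding m(1) using p2 m0 by (intro of_nat_mono card_divisors_mult_le) auto
    also have "\<dots> \<le> real (Suc k) * real (card {d. d dvd m})"
      unfolding of_nat_mult using card_divisors_prime_power_le[OF p(1)]
      by (intro mult_right_mono of_nat_mono) auto
    also have "\<dots> \<le> ((if p < P then M else 1) * real (p ^ k) powr \<eta>) *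
        (M ^ card (prime_factors m \<inter> {..<P}) * real m powr \<eta>)"
      using less.IH[OF \<open>m < n\<close> m0] assms
      by (intro mult_mono Suc_le_prime_power_powr p2) auto
    also have "\<dots> = M ^ card (prime_factors n \<inter> {..<P}) * real n powr \<eta>"
      unfolding M_eq by (subst m(1)) (simp add: powr_mult)
    finally show ?thesis .
  qed
qed

text \<open>\<open>M ^ P\<close> serves as K, because n has at most P prime factors below P.\<close>

lemma divisor_bound:
  fixes \<eta> :: real
  assumes "\<eta> > 0"
  shows "\<exists>K>0. \<forall>n>0. real (card {d::nat. d dvd n}) \<le> K * real n powr \<eta>"
proof -
  define M where "M = 1 + 1 / (\<eta> * ln 2)"
  define P where "P = nat \<lceil>2 powr (1 / \<eta>)\<rceil>"
  have M: "M \<ge> 1" "M * (\<eta> * ln 2) \<ge> 1"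
    using assms by (auto simp: M_def field_simps)
  have P: "real P \<ge> 2 powr (1 / \<eta>)"
    unfolding P_def by (rule real_nat_ceiling_ge)
  have "real (card {d. d dvd n}) \<le> M ^ P * real n powr \<eta>" if "n > 0" for n :: nat
  proof -
    have "card (prime_factors n \<inter> {..<P}) \<le> card {..<P}"
      by (intro card_mono) auto
    then have "M ^ card (prime_factors n \<inter> {..<P}) \<le> M ^ P"
      using M by (intro power_increasing) auto
    then show ?thesis
      using card_divisors_le_power_mult_powr[OF assms M P that]
      by (meson mult_right_mono order_trans powr_ge_zero)
  qed
  then show ?thesis
    using M by (intro exI[of _ "M ^ P"]) auto
qed

section \<open>Differences of squares and the Cauchy-Schwarz count\<close>

text \<open>If h = x^2 - y^2 = (x - y)(x + y), then the divisor d = x - y of h determines the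
  pair.\<close>

lemma card_square_differences_le:
  fixes h :: nat
  assumes "h > 0"
  shows "finite {(s, t). s \<in> range (\<lambda>x. x\<^sup>2) \<and> t \<in> range (\<lambda>x. x\<^sup>2) \<and> s = t + h}" (is "finite ?X")
    and "card {(s, t). s \<in> range (\<lambda>x. x\<^sup>2) \<and> t \<in> range (\<lambda>x. x\<^sup>2) \<and> s = t + h} \<le> card {d. d dvd h}"
proof -
  \<comment> \<open>With d = x - y one has \<open>h div d = x + y\<close>, so half the sum and half
    the difference recover x and y.\<close>
  let ?g = "\<lambda>d. (((h div d + d) div 2)\<^sup>2, ((h div d - d) div 2)\<^sup>2)"
  have sub: "?X \<subseteq> ?g ` {d. d dvd h}"
  proof clarify
    fix x y :: nat
    assume eq: "x\<^sup>2 = y\<^sup>2 + h"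
    then have "y\<^sup>2 < x\<^sup>2"
      using assms by simp
    then have "y < x"
      by (rule power_less_imp_less_base) simp
    then obtain d where d: "x = y + d" "d > 0"
      by (metis less_imp_add_positive)
    then have h: "h = d * (2 * y + d)"
      using eq by (simp add: power2_eq_square algebra_simps)
    then have "h div d = 2 * y + d"
      using d by simp
    then have "?g d = (x\<^sup>2, y\<^sup>2)"
      using d by simp
    then show "(x\<^sup>2, y\<^sup>2) \<in> ?g ` {d. d dvd h}"
      using h by (metis (mono_tags, lifting) dvd_triv_left image_eqI mem_Collect_eq)
  qed
  have fin: "finite {d. d dvd h}"
    using assms by simp
  show "finite ?X"
    using sub fin finite_subset by blast
  show "card ?X \<le> card {d. d dvd h}"
    using sub fin by (meson card_image_le card_mono finite_imageI le_trans)
qed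

text \<open>The fibres of f over B have sizes summing to \<open>card X\<close>, and their squares
  sum to the number of collisions; Cauchy-Schwarz compares the two sums.\<close>

lemma card_square_le_card_mult_collisions:
  assumes "finite X" "finite B" "f ` X \<subseteq> B"
  shows "(card X)\<^sup>2 \<le> card B * card {(x, y). x \<in> X \<and> y \<in> X \<and> f x = f y}"
proof -
  define F where "F b = {x \<in> X. f x = b}" for b
  have finF: "finite (F b)" for b
    using assms by (simp add: F_def)
  have "X = (\<Union>b\<in>B. F b)"
    using assms by (auto simp: F_def)
  then have X: "card X = (\<Sum>b\<in>B. card (F b))"
    using assms finF by (subst card_UN_disjoint[symmetric]) (auto simp: F_def)
  have "{(x, y). x \<in> X \<and> y \<in> X \<and> f x = f y} = (\<Union>b\<in>B. F b \<times> F b)"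
    using assms by (auto simp: F_def)
  then have C: "card {(x, y). x \<in> X \<and> y \<in> X \<and> f x = f y} = (\<Sum>b\<in>B. (card (F b))\<^sup>2)"
    using assms finF
    by (simp, subst card_UN_disjoint) (auto simp: F_def card_cartesian_product power2_eq_square)
  have "(\<Sum>b\<in>B. 1 * real (card (F b)))\<^sup>2 \<le> (\<Sum>b\<in>B. 1\<^sup>2) * (\<Sum>b\<in>B. (real (card (F b)))\<^sup>2)"
    by (rule Cauchy_Schwarz_ineq_sum)
  then have "real ((card X)\<^sup>2) \<le> real (card B * card {(x, y). x \<in> X \<and> y \<in> X \<and> f x = f y})"
    unfolding X C by simp
  then show ?thesis
    by (simp only: of_nat_le_iff)
qed

text \<open>Collisions of (n, s) \<mapsto> n - s on Z \<times> T are grouped by the pair of first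
  coordinates: equal ones force equal second coordinates, distinct ones leave at most D choices. The
  condition s \<le> n keeps natural subtraction from truncating.\<close>

lemma card_product_square_le:
  fixes Z T B :: "nat set" and D :: nat
  assumes fin: "finite Z" "finite T" "finite B"
    and le: "\<And>n s. n \<in> Z \<Longrightarrow> s \<in> T \<Longrightarrow> s \<le> n"
    and diff: "\<And>n s. n \<in> Z \<Longrightarrow> s \<in> T \<Longrightarrow> n - s \<in> B"
    and D: "\<And>m n. m \<in> Z \<Longrightarrow> n \<in> Z \<Longrightarrow> m < n \<Longrightarrow>
      card {(s, t). s \<in> T \<and> t \<in> T \<and> s = t + (n - m)} \<le> D"
  shows "(card Z * card T)\<^sup>2 \<le> card B * (card Z * card T + (card Z)\<^sup>2 * D)"
proof -
  let ?E = "\<lambda>(m, n). {(s, t). s \<in> T \<and> t \<in> T \<and> m - s = n - t}"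
  let ?Y = "{(u, v). u \<in> Z \<times> T \<and> v \<in> Z \<times> T \<and> (case u of (n, s) \<Rightarrow> n - s) = (case v of (n, s) \<Rightarrow> n - s)}"
  have finE: "finite (?E q)" for q
    using fin by (cases q) (auto intro: finite_subset[of _ "T \<times> T"])
  have E_le: "card (?E q) \<le> (if fst q = snd q then card T else D)" if q_in: "q \<in> Z \<times> Z" for q
  proof -
    obtain m n where q: "q = (m, n)" "m \<in> Z" "n \<in> Z"
      using q_in by auto
    consider "m = n" | "m < n" | "n < m"
      by linarith
    then show ?thesis
    proof cases
      case 1
      have "m - s = n - t \<longleftrightarrow> t = s" if "s \<in> T" "t \<in> T" for s t
        using le[OF q(2) that(1)] le[OF q(3) that(2)] 1 by linarith
      then have "?E (m, n) = (\<lambda>s. (s, s)) ` T"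
        by (auto simp: image_iff)
      then show ?thesis
        using 1 q fin by (simp add: card_image inj_on_def)
    next
      case 2
      \<comment> \<open>For m < n the second square is the larger one, so the coordinates are
        exchanged to match the form of \<open>D\<close>.\<close>
      have "?E (m, n) = prod.swap ` {(s, t). s \<in> T \<and> t \<in> T \<and> s = t + (n - m)}"
      proof -
        have "m - s = n - t \<longleftrightarrow> t = s + (n - m)" if "s \<in> T" "t \<in> T" for s t
          using le[OF q(2) that(1)] le[OF q(3) that(2)] 2 by linarith
        then show ?thesis
          by (auto simp: image_iff)
      qed
      then show ?thesis
        using 2 q D[of m n] by (simp add: card_image)
    next
      case 3
      have "m - s = n - t \<longleftrightarrow> s = t + (m - n)" if "s \<in> T" "t \<in> T" for s t
        using le[OF q(2) that(1)] le[OF q(3) that(2)] 3 by linarith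
      then have "?E (m, n) = {(s, t). s \<in> T \<and> t \<in> T \<and> s = t + (m - n)}"
        by auto
      then show ?thesis
        using 3 q D[of n m] by simp
    qed
  qed
  have "bij_betw (\<lambda>((m, n), (s, t)). ((m, s), (n, t))) (SIGMA q:Z \<times> Z. ?E q) ?Y"
    by (rule bij_betwI[where g = "\<lambda>((m, s), (n, t)). ((m, n), (s, t))"]) auto
  then have "card ?Y = card (SIGMA q:Z \<times> Z. ?E q)"
    by (rule bij_betw_same_card[symmetric])
  also have "\<dots> = (\<Sum>q\<in>Z \<times> Z. card (?E q))"
    using fin finE by (intro card_SigmaI) auto
  also have "\<dots> \<le> (\<Sum>q\<in>Z \<times> Z. (if fst q = snd q then card T else D))"
    by (rule sum_mono[OF E_le])
  \<comment> \<open>Adding D on the diagonal too makes the sum split into a diagonal part and a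
    constant part.\<close>
  also have "\<dots> \<le> (\<Sum>q\<in>Z \<times> Z. (if fst q = snd q then card T else 0) + D)"
    by (rule sum_mono) auto
  also have "\<dots> = (\<Sum>m\<in>Z. \<Sum>n\<in>Z. (if m = n then card T else 0)) + (card Z)\<^sup>2 * D"
    unfolding sum.distrib
    by (simp add: sum.cartesian_product card_cartesian_product power2_eq_square case_prod_beta)
  also have "\<dots> = card Z * card T + (card Z)\<^sup>2 * D"
    using fin by simp
  finally have "card ?Y \<le> card Z * card T + (card Z)\<^sup>2 * D" .
  then have "card B * card ?Y \<le> card B * (card Z * card T + (card Z)\<^sup>2 * D)"
    by (rule mult_le_mono2)
  moreover have "(card (Z \<times> T))\<^sup>2 \<le> card B * card ?Y"
    using fin diff by (intro card_square_le_card_mult_collisions) auto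
  ultimately show ?thesis
    unfolding card_cartesian_product by (rule order_trans[rotated])
qed

text \<open>The intervals fit together: removing s \<le> N from n in (2N, 3N] stays in (N, 3N], and
  two such n differ by less than N, so divisor counts up to N suffice.\<close>

lemma exceptional_set_square_le:
  fixes A S :: "nat set" and N D :: nat
  assumes S: "S \<subseteq> range (\<lambda>x. x\<^sup>2)"
    and D: "\<And>h. 0 < h \<Longrightarrow> h \<le> N \<Longrightarrow> card {d. d dvd h} \<le> D"
  defines "z \<equiv> count_in (pos_compl (A + S)) (2 * N) (3 * N)"
    and "t \<equiv> count_in S 0 N"
    and "b \<equiv> count_in (pos_compl A) N (3 * N)"
  shows "(z * t)\<^sup>2 \<le> b * (z * t + z\<^sup>2 * D)"
  unfolding z_def t_def b_def count_in_def
proof (rule card_product_square_le)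
  fix n s
  assume n: "n \<in> pos_compl (A + S) \<inter> {2 * N<..3 * N}" and s: "s \<in> S \<inter> {0<..N}"
  then have "n - s \<notin> A"
    using set_plus_intro[of "n - s" A s S] by (auto simp: pos_compl_def)
  then show "n - s \<in> pos_compl A \<inter> {N<..3 * N}"
    using n s by (auto simp: pos_compl_def)
next
  fix m n
  assume mn: "m \<in> pos_compl (A + S) \<inter> {2 * N<..3 * N}" "n \<in> pos_compl (A + S) \<inter> {2 * N<..3 * N}" "m < n"
  have "card {(s, t). s \<in> S \<inter> {0<..N} \<and> t \<in> S \<inter> {0<..N} \<and> s = t + (n - m)}
      \<le> card {(s, t). s \<in> range (\<lambda>x. x\<^sup>2) \<and> t \<in> range (\<lambda>x. x\<^sup>2) \<and> s = t + (n - m)}"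
    using S mn by (intro card_mono card_square_differences_le(1)) auto
  also have "\<dots> \<le> card {d. d dvd n - m}"
    using mn by (intro card_square_differences_le(2)) auto
  also have "\<dots> \<le> D"
    using mn by (intro D) auto
  finally show "card {(s, t). s \<in> S \<inter> {0<..N} \<and> t \<in> S \<inter> {0<..N} \<and> s = t + (n - m)} \<le> D" .
qed auto

section \<open>Comparison of the diagonal and off-diagonal terms\<close>

text \<open>One of the two summands on the right is at least half of the total; cancelling
  \<open>z * t\<close> or \<open>z\<^sup>2\<close> gives the respective alternative.\<close>

lemma mult_le_or_square_le:
  fixes z t b D :: real
  assumes "z > 0" "t > 0" "(z * t)\<^sup>2 \<le> b * (z * t + z\<^sup>2 * D)"
  shows "z * t \<le> 2 * b \<or> t\<^sup>2 \<le> 2 * b * D"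
proof (rule ccontr)
  assume "\<not> ?thesis"
  then have "z * t > 2 * b" "t\<^sup>2 > 2 * b * D"
    by auto
  then have "(z * t) * (z * t) > (z * t) * (2 * b)" "z\<^sup>2 * t\<^sup>2 > z\<^sup>2 * (2 * b * D)"
    using assms by (auto intro: mult_strict_left_mono)
  then show False
    using assms(3) by (simp add: power2_eq_square algebra_simps)
qed

theorem theorem1p2:
  "\<forall>\<epsilon>::real. \<epsilon> > 0 \<longrightarrow>
     (\<exists>C::real. C > 0 \<and>
       (\<forall>S A :: nat set.
          high_density_powers 2 S \<longrightarrow>
          A \<subseteq> {0<..} \<longrightarrow>
          compl_growth_exponent_less A 1 \<longrightarrow>
          (\<exists>N0::nat. \<forall>N\<ge>N0.
             real (count_in (pos_compl (A + S)) (2 * N) (3 * N))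
               \<le> C * real N powr (\<epsilon> - 1 / 2) * real (count_in (pos_compl A) N (3 * N)))))"
proof (rule allI, rule impI, rule exI[of _ 2], intro conjI allI impI)
  \<comment> \<open>The witness 2 for C is the factor lost in \<open>mult_le_or_square_le\<close>;
    the divisor constant is absorbed by taking N large.\<close>
  fix \<epsilon> :: real and S A :: "nat set"
  assume \<epsilon>: "\<epsilon> > 0" and S: "high_density_powers 2 S" and A: "compl_growth_exponent_less A 1"
  obtain \<delta> where \<delta>: "\<delta> > 0"
    "\<forall>\<^sub>F N in sequentially. real (count_in (pos_compl A) 0 N) < real N powr (1 - \<delta>)"
    using A unfolding compl_growth_exponent_less_def by blast
  \<comment> \<open>The bound \<eta> \<le> \<epsilon> serves the final exponent. The bound 4\<eta>
    \<le> \<delta> makes the off-diagonal exponent (1 - 4\<eta>) + \<eta> smaller than the exponent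
    1 - 2\<eta> coming from the squared density of S.\<close>
  define \<eta> where "\<eta> = min \<epsilon> (\<delta> / 4)"
  have \<eta>: "\<eta> > 0" "\<eta> \<le> \<epsilon>" "4 * \<eta> \<le> \<delta>"
    using \<epsilon> \<delta> by (auto simp: \<eta>_def)
  obtain K where K: "K > 0" "\<And>n::nat. n > 0 \<Longrightarrow> real (card {d. d dvd n}) \<le> K * real n powr \<eta>"
    using divisor_bound[OF \<eta>(1)] by blast
  have S_sq: "S \<subseteq> range (\<lambda>x. x\<^sup>2)"
    using S unfolding high_density_powers_def by auto
  have ev_S: "\<forall>\<^sub>F N in sequentially. real (count_in S 0 N) > real N powr (1 / 2 - \<eta>)"
    using S \<eta>(1) unfolding high_density_powers_def by simp
  have "filterlim (\<lambda>N::nat. 3 * N) sequentially sequentially"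
    by (rule mult_nat_left_at_top) simp
  then have ev_A: "\<forall>\<^sub>F N in sequentially. real (count_in (pos_compl A) 0 (3 * N)) < real (3 * N) powr (1 - \<delta>)"
    using eventually_compose_filterlim[OF \<delta>(2)] by blast
  \<comment> \<open>In 6K the 2 comes from the dichotomy, the 3 from counting up to 3N, and K from
    the divisor bound.\<close>
  have ev_K: "\<forall>\<^sub>F N in sequentially. 6 * K < real N powr \<eta>"
    using \<eta>(1) by real_asymp
  have "\<forall>\<^sub>F N in sequentially. real (count_in (pos_compl (A + S)) (2 * N) (3 * N))
      \<le> 2 * real N powr (\<epsilon> - 1 / 2) * real (count_in (pos_compl A) N (3 * N))"
    using ev_S ev_A ev_K eventually_gt_at_top[of 0]
  proof eventually_elim
    case (elim N)
    define z where "z = count_in (pos_compl (A + S)) (2 * N) (3 * N)"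
    define t where "t = count_in S 0 N"
    define b where "b = count_in (pos_compl A) N (3 * N)"
    \<comment> \<open>Divisor counts are integers, so rounding down keeps D an upper bound for
      them.\<close>
    define D where "D = nat \<lfloor>K * real N powr \<eta>\<rfloor>"
    have D: "real D \<le> K * real N powr \<eta>"
      unfolding D_def using K by simp
    have "card {d. d dvd h} \<le> D" if "0 < h" "h \<le> N" for h
    proof -
      have "real (card {d. d dvd h}) \<le> K * real h powr \<eta>"
        using K that by simp
      also have "\<dots> \<le> K * real N powr \<eta>"
        using K that \<eta> by (intro mult_left_mono powr_mono2) auto
      finally show ?thesis
        unfolding D_def by (simp add: le_nat_floor)
    qed
    then have main: "(z * t)\<^sup>2 \<le> b * (z * t + z\<^sup>2 * D)"
      unfolding z_def t_def b_def by (rule exceptional_set_square_le[OF S_sq])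
    have t_gt: "real t > real N powr (1 / 2 - \<eta>)"
      using elim unfolding t_def by simp
    then have t0: "real t > 0"
      by (rule le_less_trans[OF powr_ge_zero])
    have "b \<le> count_in (pos_compl A) 0 (3 * N)"
      unfolding b_def count_in_def by (intro card_mono) auto
    then have "real b < (3 * real N) powr (1 - \<delta>)"
      using elim by simp
    also have "\<dots> = 3 powr (1 - \<delta>) * real N powr (1 - \<delta>)"
      by (simp add: powr_mult)
    also have "\<dots> \<le> 3 powr 1 * real N powr (1 - 4 * \<eta>)"
      using \<eta> \<delta> elim by (intro mult_mono powr_mono) auto
    finally have b_lt: "real b < 3 * real N powr (1 - 4 * \<eta>)"
      by simp
    have not_off_diagonal: "\<not> (real t)\<^sup>2 \<le> 2 * real b * real D"
    proof
      assume "(real t)\<^sup>2 \<le> 2 * real b * real D"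
      also have "\<dots> \<le> 2 * (3 * real N powr (1 - 4 * \<eta>)) * (K * real N powr \<eta>)"
        using b_lt D by (intro mult_mono) auto
      also have "\<dots> = 6 * K * real N powr (1 - 3 * \<eta>)"
        by (simp add: powr_add[symmetric])
      \<comment> \<open>The spare factor \<open>N powr \<eta>\<close> beats 6K and raises the
        exponent to exactly 1 - 2\<eta>.\<close>
      also have "\<dots> < real N powr \<eta> * real N powr (1 - 3 * \<eta>)"
        using elim by (intro mult_strict_right_mono) auto
      also have "\<dots> = (real N powr (1 / 2 - \<eta>))\<^sup>2"
        by (simp add: powr_add[symmetric] power2_eq_square)
      also have "\<dots> \<le> (real t)\<^sup>2"
        using t_gt by (intro power_mono) auto
      finally show False by simp
    qed
    have "real z \<le> 2 * real N powr (\<epsilon> - 1 / 2) * real b"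
    proof (cases "z = 0")
      case False
      have "(real z * real t)\<^sup>2 \<le> real b * (real z * real t + (real z)\<^sup>2 * real D)"
        using of_nat_mono[OF main, where 'a = real] by simp
      then have "real z * real t \<le> 2 * real b"
        using mult_le_or_square_le[of "real z" "real t"] False t0 not_off_diagonal by auto
      then have "real z * real N powr (1 / 2 - \<eta>) \<le> 2 * real b"
        using t_gt by (meson less_imp_le mult_left_mono of_nat_0_le_iff order_trans)
      then have "real z * real N powr (1 / 2 - \<eta>) * real N powr (\<eta> - 1 / 2) \<le> 2 * real b * real N powr (\<eta> - 1 / 2)"
        by (rule mult_right_mono) simp
      then have "real z \<le> 2 * real b * real N powr (\<eta> - 1 / 2)"
        using elim by (simp add: mult.assoc powr_add[symmetric])
      also have "\<dots> \<le> 2 * real b * real N powr (\<epsilon> - 1 / 2)"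
        using \<eta> elim by (intro mult_left_mono powr_mono) auto
      finally show ?thesis
        by (simp add: mult_ac)
    qed simp
    then show ?case
      unfolding z_def b_def .
  qed
  then show "\<exists>N0. \<forall>N\<ge>N0. real (count_in (pos_compl (A + S)) (2 * N) (3 * N))
      \<le> 2 * real N powr (\<epsilon> - 1 / 2) * real (count_in (pos_compl A) N (3 * N))"
    by (simp add: eventually_sequentially)
qed simp

end
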